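(* Let $(\Phi,\mathfrak N,\mathfrak T,\mathfrak R,\mathfrak S,\phi_{\mathrm{start}},\Sigma,\mathrm{Lex},\mathrm{Sel})$ be a parameterized local lexing, $D\in\Sigma^*$, $0\le k\le|D|$, $T$ a set of parameterized tokens, $I$ a set of parameterized items and $I'$ a set of ordinary items of the induced grammar. If $I\sim I'$, then $\mathcal U(\mathrm{Tokens}\,T\,k\,I)=\mathrm{Tokens}'\,\mathcal U(T)\,k\,I'$.
   Context: $\Phi$ is a non-empty set; $\mathfrak N,\mathfrak T$ disjoint sets of nonterminals and terminals; $\mathfrak S\in\mathfrak N$, $\phi_{\mathrm{start}}\in\Phi$; $\mathfrak R$ a set of parameterized rules $N_{f_{k+1}}\to X_1^{f_1}\cdots X_k^{f_k}$ ($k\ge0$, $N\in\mathfrak N$, $X_i\in\mathfrak N\cup\mathfrak T$, partial $f_i:\Phi^{2i-1}\rightharpoonup\Phi$); $\Sigma$ a set of characters; $\mathrm{Lex}$ assigns to each $(t,\alpha,D,k)$ ($t\in\mathfrak T,\alpha\in\Phi,D\in\Sigma^*,0\le k\le|D|$) a set of parameterized tokens $(t,\alpha,\beta,c)\in\mathfrak T\times\Phi\times\Phi\times\Sigma^*$ with $k+|c|\le|D|$, $c_i=D_{k+i}$ for $0\le i<|c|$; $\mathrm{Sel}$ maps pairs $(A,B)$ of sets of parameterized tokens to a set, with $A\subseteq\mathrm{Sel}(A,B)\subseteq B$ whenever $A\subseteq B$. Sequences indexed from 0; $\mathrm{take}_n$ takes the first $n$ entries. $\langle f_1,\dots,f_u\rangle$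 is the set of $\rho\in\Phi^{2u}$ with $f_i$ defined at $(\rho_0,\dots,\rho_{2i-2})$ and $\rho_{2i-1}=f_i(\rho_0,\dots,\rho_{2i-2})$ for $i=1,\dots,u$. Induced grammar: nonterminals $(\mathfrak N\times\Phi\times\Phi)\cup\{\top,\bot\}$, terminals $\overline{\mathfrak T}=\mathfrak T\times\Phi\times\Phi$, triples written $X^\alpha_\beta$; rules $\overline{\mathfrak R}=\{\top\to\mathfrak S^{\phi_{\mathrm{start}}}_\beta\mid\beta\in\Phi\}\cup\bigcup_{r\in\mathfrak R}\overline r$, where for $r=N_{f_{k+1}}\to X_1^{f_1}\cdots X_k^{f_k}$, $\overline r$ consists of (i) rules $N^\alpha_\beta\to(X_1)^{\alpha_1}_{\beta_1}\cdots(X_k)^{\alpha_k}_{\beta_k}$ with $(\alpha,\alpha_1,\beta_1,\dots,\alpha_k,\beta_k,\beta)\in\langle f_1,\dots,f_{k+1}\rangle$, and (ii) rules $N^\alpha_\beta\to(X_1)^{\alpha_1}_{\beta_1}\cdots(X_h)^{\alpha_h}_{\beta_h}\bot$ with $1\le h\le k$, $\beta,\beta_h\in\Phi$, $(\alpha,\alpha_1,\beta_1,\dots,\alpha_h)\in\langle f_1,\dots,f_h\rangle$ and $f_{h+1}$ undefined at $(\alpha,\alpha_1,\beta_1,\dots,\alpha_h,\beta_h)$. Induced lexer $\overline{\mathrm{Lex}}(t^\alpha_\beta)(D,k)=\{(t^\alpha_\beta,c)\mid(t,\alpha,\beta,c)\in\mathrm{Lex}(t,\alpha,D,k)\}$.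 $\mathcal U(t,\alpha,\beta,c)=(t^\alpha_\beta,c)$ is a bijection onto $\overline{\mathfrak T}\times\Sigma^*$, lifted to sets; induced selector $\overline{\mathrm{Sel}}(A,B)=\mathcal U(\mathrm{Sel}(\mathcal U^{-1}A,\mathcal U^{-1}B))$. Items: parameterized item $(r,d,i,j,\rho)$ with $r=N_{f_{v+1}}\to X_1^{f_1}\cdots X_v^{f_v}\in\mathfrak R$, $0\le d\le v$, $0\le i\le j\le|D|$, $\rho\in\langle f_1,\dots,f_{d+1}\rangle$. Ordinary item $(q,d,i,j)$ with $q=(L\to w)\in\overline{\mathfrak R}$, $0\le d\le|w|$, $0\le i\le j\le|D|$, written $(L\to w_1\bullet w_2,i,j)$, $|w_1|=d$. For $x=(r,d,i,j,\rho)$, $\overline x$ consists of all $(q,d,i,j)$ with $q\in\overline r$ of type (i) and $\mathrm{take}_{2(d+1)}(\alpha,\alpha_1,\beta_1,\dots,\alpha_k,\beta_k,\beta)=\rho$, and all $(q,d,i,j)$ with $q\in\overline r$ of type (ii), $d\le h-1$, $\mathrm{take}_{2(d+1)}(\alpha,\alpha_1,\beta_1,\dots,\alpha_h)=\rho$. $\overline I=\bigcup_{x\in I}\overline x$; $\mathrm{Norm}(I')=\{(L\to w_1\bullet w_2,i,j)\in I'\mid L\ne\top,\ w_2\text{ is not the one-symbol string }\bot\}$; $I\sim I'$ means $\overline I=\mathrm{Norm}(I')$. $\mathrm{Tokens}\,T\,k\,I=\mathrm{Sel}(T,V)$ with $V=\{x\mid(r,d,i,k,\rho)\in I,\ r=N_{f_{v+1}}\to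 X_1^{f_1}\cdots X_v^{f_v},\ d<v,\ X_{d+1}\in\mathfrak T,\ x\in\mathrm{Lex}(X_{d+1},\rho_{2d+1},D,k)\}$. $\mathrm{Tokens}'\,T'\,k\,I'=\overline{\mathrm{Sel}}(T',V')$ with $V'=\{x\mid(L\to a\bullet t\,b,i,k)\in I',\ t\in\overline{\mathfrak T},\ x\in\overline{\mathrm{Lex}}(t)(D,k)\}$. *)

theory Defs
  imports Main
begin

text \<open>
  A partial function from \<open>\<Phi>\<^sup>n\<close> to \<open>\<Phi>\<close> is a map on lists whose domain consists of lists of length
  \<open>n\<close> over \<open>\<Phi>\<close> (so functions are compared by their graphs).
\<close>

type_synonym 'p pfun = "'p list \<Rightarrow> 'p option"

definition partial_functions :: "'p set \<Rightarrow> nat \<Rightarrow> 'p pfun set" where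
  "partial_functions \<Phi> n = {f. dom f \<subseteq> {xs \<in> lists \<Phi>. length xs = n} \<and> ran f \<subseteq> \<Phi>}"

text \<open>
  \<open>PRule N g [(X\<^sub>1, f\<^sub>1), \<dots>, (X\<^sub>k, f\<^sub>k)]\<close> is the parameterized rule with left-hand side \<open>N\<close>, right-hand
  side symbols \<open>X\<^sub>i\<close> carrying \<open>f\<^sub>i\<close>, and \<open>g\<close> in the role of \<open>f\<^sub>k\<^sub>+\<^sub>1\<close>.
\<close>

datatype ('s, 'p) prule = PRule (lhs: 's) (final: "'p pfun") (rhs: "('s \<times> 'p pfun) list")

definition symbols :: "('s, 'p) prule \<Rightarrow> 's list" where
  "symbols r = map fst (rhs r)"

definition funs :: "('s, 'p) prule \<Rightarrow> 'p pfun list" where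
  "funs r = map snd (rhs r) @ [final r]"

type_synonym ('s, 'p, 'c) ptoken = "'s \<times> 'p \<times> 'p \<times> 'c list"

record ('s, 'p, 'c) lexing_data =
  Params :: "'p set"
  Nonterms :: "'s set"
  Terms :: "'s set"
  Rules :: "('s, 'p) prule set"
  start_sym :: "'s"
  start_param :: "'p"
  Chars :: "'c set"
  Lex :: "'s \<Rightarrow> 'p \<Rightarrow> 'c list \<Rightarrow> nat \<Rightarrow> ('s, 'p, 'c) ptoken set"
  Sel :: "('s, 'p, 'c) ptoken set \<Rightarrow> ('s, 'p, 'c) ptoken set \<Rightarrow> ('s, 'p, 'c) ptoken set"

definition ptokens :: "('s, 'p, 'c) lexing_data \<Rightarrow> ('s, 'p, 'c) ptoken set" where
  "ptokens P = Terms P \<times> Params P \<times> Params P \<times> lists (Chars P)"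

text \<open>
  \<open>Lex\<close> is constrained only on arguments in its intended domain, and \<open>Sel\<close> only on pairs \<open>A \<subseteq> B\<close> of
  sets of parameterized tokens.  Lists are indexed from 0, so \<open>funs r ! i\<close> is \<open>f\<^sub>i\<^sub>+\<^sub>1\<close>, of arity
  \<open>2 * (i + 1) - 1\<close>.
\<close>

locale parameterized_local_lexing =
  fixes P :: "('s, 'p, 'c) lexing_data"
  assumes params_nonempty: "Params P \<noteq> {}"
    and disjoint: "Nonterms P \<inter> Terms P = {}"
    and start_sym: "start_sym P \<in> Nonterms P"
    and start_param: "start_param P \<in> Params P"
    and rule_lhs: "r \<in> Rules P \<Longrightarrow> lhs r \<in> Nonterms P"
    and rule_symbols: "r \<in> Rules P \<Longrightarrow> set (symbols r) \<subseteq> Nonterms P \<union> Terms P"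
    and rule_funs: "r \<in> Rules P \<Longrightarrow> i < length (funs r) \<Longrightarrow>
          funs r ! i \<in> partial_functions (Params P) (2 * i + 1)"
    and Lex: "t \<in> Terms P \<Longrightarrow> \<alpha> \<in> Params P \<Longrightarrow> D \<in> lists (Chars P) \<Longrightarrow> k \<le> length D \<Longrightarrow>
          Lex P t \<alpha> D k \<subseteq> {(t, \<alpha>, \<beta>, c) | \<beta> c. \<beta> \<in> Params P \<and> c \<in> lists (Chars P) \<and>
            k + length c \<le> length D \<and> (\<forall>i<length c. c ! i = D ! (k + i))}"
    and Sel: "A \<subseteq> B \<Longrightarrow> B \<subseteq> ptokens P \<Longrightarrow> A \<subseteq> Sel P A B \<and> Sel P A B \<subseteq> B"

definition bracket :: "'p set \<Rightarrow> 'p pfun list \<Rightarrow> 'p list set" where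
  "bracket \<Phi> fs = {\<rho> \<in> lists \<Phi>. length \<rho> = 2 * length fs \<and>
     (\<forall>i<length fs. (fs ! i) (take (2 * i + 1) \<rho>) = Some (\<rho> ! (2 * i + 1)))}"

subsection \<open>The induced grammar, lexer and selector\<close>

text \<open>\<open>Sym X \<alpha> \<beta>\<close> is the triple usually written \<open>X\<close> with superscript \<open>\<alpha>\<close> and subscript \<open>\<beta>\<close>.\<close>

datatype ('s, 'p) isym = Sym 's 'p 'p | Top | Bot

type_synonym ('s, 'p) irule = "('s, 'p) isym \<times> ('s, 'p) isym list"

definition induced_nonterms :: "('s, 'p, 'c) lexing_data \<Rightarrow> ('s, 'p) isym set" where
  "induced_nonterms P =
     {Sym N \<alpha> \<beta> | N \<alpha> \<beta>. N \<in> Nonterms P \<and> \<alpha> \<in> Params P \<and> \<beta> \<in> Params P} \<union> {Top, Bot}"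

definition induced_terms :: "('s, 'p, 'c) lexing_data \<Rightarrow> ('s, 'p) isym set" where
  "induced_terms P = {Sym t \<alpha> \<beta> | t \<alpha> \<beta>. t \<in> Terms P \<and> \<alpha> \<in> Params P \<and> \<beta> \<in> Params P}"

text \<open>For \<open>ps = [(\<alpha>\<^sub>1, \<beta>\<^sub>1), \<dots>, (\<alpha>\<^sub>h, \<beta>\<^sub>h)]\<close>, \<open>path \<alpha> ps\<close> is \<open>[\<alpha>, \<alpha>\<^sub>1, \<beta>\<^sub>1, \<dots>, \<alpha>\<^sub>h, \<beta>\<^sub>h]\<close>.\<close>

definition path :: "'p \<Rightarrow> ('p \<times> 'p) list \<Rightarrow> 'p list" where
  "path \<alpha> ps = \<alpha> # concat (map (\<lambda>(a, b). [a, b]) ps)"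

text \<open>\<open>zip\<close> truncates, so a list \<open>ps\<close> of length \<open>h\<close> instantiates the first \<open>h\<close> symbols only.\<close>

definition inst_symbols :: "('s, 'p) prule \<Rightarrow> ('p \<times> 'p) list \<Rightarrow> ('s, 'p) isym list" where
  "inst_symbols r ps = map (\<lambda>(X, a, b). Sym X a b) (zip (symbols r) ps)"

definition complete_inst ::
    "('s, 'p, 'c) lexing_data \<Rightarrow> ('s, 'p) prule \<Rightarrow> 'p \<Rightarrow> ('p \<times> 'p) list \<Rightarrow> 'p \<Rightarrow> bool" where
  "complete_inst P r \<alpha> ps \<beta> \<longleftrightarrow> length ps = length (rhs r) \<and>
     path \<alpha> ps @ [\<beta>] \<in> bracket (Params P) (funs r)"

definition complete_rule :: "('s, 'p) prule \<Rightarrow> 'p \<Rightarrow> ('p \<times> 'p) list \<Rightarrow> 'p \<Rightarrow> ('s, 'p) irule" where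
  "complete_rule r \<alpha> ps \<beta> = (Sym (lhs r) \<alpha> \<beta>, inst_symbols r ps)"

text \<open>
  With \<open>h = length ps\<close>, \<open>butlast (path \<alpha> ps)\<close> is \<open>[\<alpha>, \<alpha>\<^sub>1, \<beta>\<^sub>1, \<dots>, \<alpha>\<^sub>h]\<close>, and \<open>funs r ! h\<close> is \<open>f\<^sub>h\<^sub>+\<^sub>1\<close>.
\<close>

definition stuck_inst ::
    "('s, 'p, 'c) lexing_data \<Rightarrow> ('s, 'p) prule \<Rightarrow> 'p \<Rightarrow> ('p \<times> 'p) list \<Rightarrow> 'p \<Rightarrow> bool" where
  "stuck_inst P r \<alpha> ps \<beta> \<longleftrightarrow> 1 \<le> length ps \<and> length ps \<le> length (rhs r) \<and>
     \<beta> \<in> Params P \<and> snd (last ps) \<in> Params P \<and>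
     butlast (path \<alpha> ps) \<in> bracket (Params P) (take (length ps) (funs r)) \<and>
     (funs r ! length ps) (path \<alpha> ps) = None"

definition stuck_rule :: "('s, 'p) prule \<Rightarrow> 'p \<Rightarrow> ('p \<times> 'p) list \<Rightarrow> 'p \<Rightarrow> ('s, 'p) irule" where
  "stuck_rule r \<alpha> ps \<beta> = (Sym (lhs r) \<alpha> \<beta>, inst_symbols r ps @ [Bot])"

definition induced_rules_of ::
    "('s, 'p, 'c) lexing_data \<Rightarrow> ('s, 'p) prule \<Rightarrow> ('s, 'p) irule set" where
  "induced_rules_of P r =
     {complete_rule r \<alpha> ps \<beta> | \<alpha> ps \<beta>. complete_inst P r \<alpha> ps \<beta>} \<union>
     {stuck_rule r \<alpha> ps \<beta> | \<alpha> ps \<beta>. stuck_inst P r \<alpha> ps \<beta>}"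

definition induced_rules :: "('s, 'p, 'c) lexing_data \<Rightarrow> ('s, 'p) irule set" where
  "induced_rules P =
     {(Top, [Sym (start_sym P) (start_param P) \<beta>]) | \<beta>. \<beta> \<in> Params P} \<union>
     (\<Union>r\<in>Rules P. induced_rules_of P r)"

lemma last_path: "ps \<noteq> [] \<Longrightarrow> last (path \<alpha> ps) = snd (last ps)"
  by (induction ps rule: rev_induct) (auto simp: path_def)

lemma stuck_inst_path:
  assumes "stuck_inst P r \<alpha> ps \<beta>"
  shows "path \<alpha> ps \<in> lists (Params P)"
proof -
  have ne: "ps \<noteq> []" and "butlast (path \<alpha> ps) \<in> lists (Params P)"
    and "snd (last ps) \<in> Params P"
    using assms by (auto simp: stuck_inst_def bracket_def)
  moreover have "path \<alpha> ps = butlast (path \<alpha> ps) @ [snd (last ps)]"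
    using last_path[OF ne, of \<alpha>] append_butlast_last_id[of "path \<alpha> ps"] by (simp add: path_def)
  ultimately show ?thesis
    by (metis append_in_lists_conv lists.Cons lists.Nil)
qed

lemma (in parameterized_local_lexing) induced_rules_wf:
  "induced_rules P \<subseteq> induced_nonterms P \<times> lists (induced_nonterms P \<union> induced_terms P)"
proof -
  have syms: "set (inst_symbols r ps) \<subseteq> induced_nonterms P \<union> induced_terms P"
    if "r \<in> Rules P" "path \<alpha> ps \<in> lists (Params P)" for r \<alpha> ps
  proof
    fix Y assume "Y \<in> set (inst_symbols r ps)"
    then obtain X a b where Y: "Y = Sym X a b" and "(X, a, b) \<in> set (zip (symbols r) ps)"
      by (auto simp: inst_symbols_def)
    then have "X \<in> set (symbols r)" "(a, b) \<in> set ps"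
      by (blast dest: set_zip_leftD set_zip_rightD)+
    then have "X \<in> Nonterms P \<union> Terms P" "a \<in> Params P" "b \<in> Params P"
      using that rule_symbols by (fastforce simp: path_def)+
    with Y show "Y \<in> induced_nonterms P \<union> induced_terms P"
      by (auto simp: induced_nonterms_def induced_terms_def)
  qed
  have lhs: "Sym (lhs r) \<alpha> \<beta> \<in> induced_nonterms P"
    if "r \<in> Rules P" "path \<alpha> ps \<in> lists (Params P)" "\<beta> \<in> Params P" for r \<alpha> ps \<beta>
    using that rule_lhs by (auto simp: induced_nonterms_def path_def)
  have "complete_rule r \<alpha> ps \<beta> \<in> induced_nonterms P \<times> lists (induced_nonterms P \<union> induced_terms P)"
    if r: "r \<in> Rules P" and c: "complete_inst P r \<alpha> ps \<beta>" for r \<alpha> ps \<beta>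
  proof -
    have "path \<alpha> ps \<in> lists (Params P)" "\<beta> \<in> Params P"
      using c by (auto simp: complete_inst_def bracket_def)
    with r show ?thesis
      using lhs syms unfolding complete_rule_def in_lists_conv_set by blast
  qed
  moreover have "stuck_rule r \<alpha> ps \<beta> \<in> induced_nonterms P \<times> lists (induced_nonterms P \<union> induced_terms P)"
    if r: "r \<in> Rules P" and s: "stuck_inst P r \<alpha> ps \<beta>" for r \<alpha> ps \<beta>
  proof -
    have "path \<alpha> ps \<in> lists (Params P)" "\<beta> \<in> Params P"
      using stuck_inst_path[OF s] s by (auto simp: stuck_inst_def)
    moreover have "Bot \<in> induced_nonterms P"
      by (simp add: induced_nonterms_def)
    ultimately show ?thesis
      using r lhs syms[of r \<alpha> ps] by (auto simp: stuck_rule_def in_lists_conv_set)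
  qed
  moreover have "(Top, [Sym (start_sym P) (start_param P) \<beta>]) \<in>
      induced_nonterms P \<times> lists (induced_nonterms P \<union> induced_terms P)"
    if "\<beta> \<in> Params P" for \<beta>
    using that start_sym start_param by (auto simp: induced_nonterms_def)
  ultimately show ?thesis
    unfolding induced_rules_def induced_rules_of_def by blast
qed

type_synonym ('s, 'p, 'c) itoken = "('s, 'p) isym \<times> 'c list"

definition itokens :: "('s, 'p, 'c) lexing_data \<Rightarrow> ('s, 'p, 'c) itoken set" where
  "itokens P = induced_terms P \<times> lists (Chars P)"

fun \<U> :: "('s, 'p, 'c) ptoken \<Rightarrow> ('s, 'p, 'c) itoken" where
  "\<U> (t, \<alpha>, \<beta>, c) = (Sym t \<alpha> \<beta>, c)"

lemma inj_\<U>: "inj \<U>"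
  by (auto simp: inj_on_def)

lemma bij_betw_\<U>: "bij_betw \<U> (ptokens P) (itokens P)"
  unfolding bij_betw_def
proof
  show "inj_on \<U> (ptokens P)"
    using inj_\<U> inj_on_subset by blast
  show "\<U> ` ptokens P = itokens P"
    by (force simp: ptokens_def itokens_def induced_terms_def image_iff)
qed

definition induced_Lex ::
    "('s, 'p, 'c) lexing_data \<Rightarrow> ('s, 'p) isym \<Rightarrow> 'c list \<Rightarrow> nat \<Rightarrow> ('s, 'p, 'c) itoken set" where
  "induced_Lex P X D k =
     {(Sym t \<alpha> \<beta>, c) | t \<alpha> \<beta> c. X = Sym t \<alpha> \<beta> \<and> (t, \<alpha>, \<beta>, c) \<in> Lex P t \<alpha> D k}"

definition induced_Sel :: "('s, 'p, 'c) lexing_data \<Rightarrow>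
    ('s, 'p, 'c) itoken set \<Rightarrow> ('s, 'p, 'c) itoken set \<Rightarrow> ('s, 'p, 'c) itoken set" where
  "induced_Sel P A B = \<U> ` Sel P (\<U> -` A) (\<U> -` B)"

subsection \<open>Items\<close>

text \<open>
  An item carries a rule, the dot position, and its start and end positions in the input; a
  parameterized item in addition carries the parameters computed so far.
\<close>

type_synonym ('s, 'p) pitem = "('s, 'p) prule \<times> nat \<times> nat \<times> nat \<times> 'p list"
type_synonym ('s, 'p) item = "('s, 'p) irule \<times> nat \<times> nat \<times> nat"

definition pitems :: "('s, 'p, 'c) lexing_data \<Rightarrow> 'c list \<Rightarrow> ('s, 'p) pitem set" where
  "pitems P D = {(r, d, i, j, \<rho>). r \<in> Rules P \<and> d \<le> length (rhs r) \<and> i \<le> j \<and> j \<le> length D \<and>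
     \<rho> \<in> bracket (Params P) (take (d + 1) (funs r))}"

definition items :: "('s, 'p, 'c) lexing_data \<Rightarrow> 'c list \<Rightarrow> ('s, 'p) item set" where
  "items P D = {((L, w), d, i, j). (L, w) \<in> induced_rules P \<and> d \<le> length w \<and>
     i \<le> j \<and> j \<le> length D}"

fun induced_items_of :: "('s, 'p, 'c) lexing_data \<Rightarrow> ('s, 'p) pitem \<Rightarrow> ('s, 'p) item set" where
  "induced_items_of P (r, d, i, j, \<rho>) =
     {(complete_rule r \<alpha> ps \<beta>, d, i, j) | \<alpha> ps \<beta>. complete_inst P r \<alpha> ps \<beta> \<and>
        take (2 * (d + 1)) (path \<alpha> ps @ [\<beta>]) = \<rho>} \<union>
     {(stuck_rule r \<alpha> ps \<beta>, d, i, j) | \<alpha> ps \<beta>. stuck_inst P r \<alpha> ps \<beta> \<and>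
        d \<le> length ps - 1 \<and> take (2 * (d + 1)) (butlast (path \<alpha> ps)) = \<rho>}"

definition induced_items ::
    "('s, 'p, 'c) lexing_data \<Rightarrow> ('s, 'p) pitem set \<Rightarrow> ('s, 'p) item set" where
  "induced_items P I = (\<Union>x\<in>I. induced_items_of P x)"

definition Norm :: "('s, 'p) item set \<Rightarrow> ('s, 'p) item set" where
  "Norm I' = {((L, w), d, i, j) | L w d i j. ((L, w), d, i, j) \<in> I' \<and> L \<noteq> Top \<and> drop d w \<noteq> [Bot]}"

definition items_equiv ::
    "('s, 'p, 'c) lexing_data \<Rightarrow> ('s, 'p) pitem set \<Rightarrow> ('s, 'p) item set \<Rightarrow> bool" where
  "items_equiv P I I' \<longleftrightarrow> induced_items P I = Norm I'"

definition Tokens :: "('s, 'p, 'c) lexing_data \<Rightarrow> 'c list \<Rightarrow>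
    ('s, 'p, 'c) ptoken set \<Rightarrow> nat \<Rightarrow> ('s, 'p) pitem set \<Rightarrow> ('s, 'p, 'c) ptoken set" where
  "Tokens P D T k I = Sel P T
     {x | x r d i \<rho>. (r, d, i, k, \<rho>) \<in> I \<and> d < length (rhs r) \<and> symbols r ! d \<in> Terms P \<and>
        x \<in> Lex P (symbols r ! d) (\<rho> ! (2 * d + 1)) D k}"

definition Tokens' :: "('s, 'p, 'c) lexing_data \<Rightarrow> 'c list \<Rightarrow>
    ('s, 'p, 'c) itoken set \<Rightarrow> nat \<Rightarrow> ('s, 'p) item set \<Rightarrow> ('s, 'p, 'c) itoken set" where
  "Tokens' P D T' k I' = induced_Sel P T'
     {x | x L a t b i. ((L, a @ t # b), length a, i, k) \<in> I' \<and> t \<in> induced_terms P \<and>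
        x \<in> induced_Lex P t D k}"

end

theory Submission
  imports Defs
begin

text \<open>
  \<open>\<U>\<close> is injective, so it suffices that the two candidate token sets correspond under \<open>\<U>\<close>.  An
  ordinary item with a terminal after the dot survives \<open>Norm\<close> and comes from a parameterized item
  with that terminal after its dot and the same input parameter.  Conversely, given a parameterized
  item and a token with output parameter \<open>\<beta>\<close>, record \<open>\<beta>\<close> as the result of the symbol after the
  dot and keep choosing arbitrary results for the later symbols.  This ends in a type (i) or a
  type (ii) rule according to whether the functions stay defined, and in both cases the induced
  item has the terminal decorated with \<open>\<beta>\<close> after its dot.
\<close>

section \<open>Parameter paths, brackets and instantiated symbols\<close>

lemma length_path: "length (path \<alpha> ps) = 2 * length ps + 1"
  by (induction ps) (auto simp: path_def)

lemma path_append: "path \<alpha> (ps @ qs) = path \<alpha> ps @ concat (map (\<lambda>(a, b). [a, b]) qs)"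
  by (simp add: path_def)

lemma butlast_path_snoc: "butlast (path \<alpha> (ps @ [(a, b)])) = path \<alpha> ps @ [a]"
  by (simp add: path_append butlast_append)

lemma take_path_append: "take (2 * length ps) (path \<alpha> (ps @ qs)) = butlast (path \<alpha> ps)"
  by (simp add: path_append butlast_conv_take length_path)

lemma path_nth: "d < length ps \<Longrightarrow> path \<alpha> ps ! (2 * d + 1) = fst (ps ! d)"
proof (induction ps rule: rev_induct)
  case (snoc p ps)
  then show ?case
    by (cases "d = length ps") (auto simp: path_append nth_append length_path split: prod.splits)
qed simp

text \<open>Used to reopen the flat parameter list of an item, once an output has been appended, as
  the pairs from which induced rules are built.\<close>

lemma odd_list_is_path:
  assumes "length xs = 2 * n + 1"
  obtains \<alpha> ps where "xs = path \<alpha> ps" and "length ps = n"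
proof -
  have "\<exists>\<alpha> ps. xs = path \<alpha> ps \<and> length ps = n"
    using assms
  proof (induction n arbitrary: xs)
    case 0
    then show ?case by (auto simp: path_def length_Suc_conv)
  next
    case (Suc n)
    obtain zs a b where xs: "xs = zs @ [a, b]" and "length zs = 2 * n + 1"
      using Suc.prems
      by (cases xs rule: rev_cases; cases "butlast xs" rule: rev_cases) auto
    then obtain \<alpha> ps where "zs = path \<alpha> ps" "length ps = n"
      using Suc.IH by blast
    then have "xs = path \<alpha> (ps @ [(a, b)])" "length (ps @ [(a, b)]) = Suc n"
      by (simp_all add: xs path_append)
    then show ?case by blast
  qed
  with that show thesis by blast
qed

text \<open>The earlier conditions only look at prefixes inside \<open>\<rho>\<close>, so the new
  entries add a single condition, the one for \<open>f\<close>.\<close>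

lemma bracket_snoc:
  assumes "\<rho> \<in> bracket \<Phi> fs" and "x \<in> \<Phi>" and "y \<in> \<Phi>" and "f (\<rho> @ [x]) = Some y"
  shows "\<rho> @ [x, y] \<in> bracket \<Phi> (fs @ [f])"
  using assms by (auto simp: bracket_def less_Suc_eq nth_append)

lemma length_funs: "length (funs r) = length (rhs r) + 1"
  by (simp add: funs_def)

lemma length_symbols: "length (symbols r) = length (rhs r)"
  by (simp add: symbols_def)

lemma length_inst_symbols:
  "length ps \<le> length (rhs r) \<Longrightarrow> length (inst_symbols r ps) = length ps"
  by (simp add: inst_symbols_def length_symbols)

lemma inst_symbols_nth:
  assumes "d < length ps" and "length ps \<le> length (rhs r)"
  shows "inst_symbols r ps ! d = Sym (symbols r ! d) (fst (ps ! d)) (snd (ps ! d))"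
  using assms by (simp add: inst_symbols_def length_symbols split: prod.splits)

section \<open>From parameterized items to ordinary items\<close>

context parameterized_local_lexing
begin

lemma fun_value_in_Params:
  assumes "r \<in> Rules P" and "i < length (funs r)" and "(funs r ! i) xs = Some y"
  shows "y \<in> Params P"
  using rule_funs[OF assms(1,2)] assms(3) by (auto simp: partial_functions_def ran_def)

text \<open>Induction on the number of symbols still lacking parameters. The bracket ends at the
  input of the last symbol, so its output may be any parameter. At least one pair is demanded
  because \<open>stuck_inst\<close> demands it.\<close>

lemma extend_to_induced_rule:
  assumes r: "r \<in> Rules P"
    and "ps \<noteq> []" and "length ps \<le> length (rhs r)"
    and "butlast (path \<alpha> ps) \<in> bracket (Params P) (take (length ps) (funs r))"
    and "snd (last ps) \<in> Params P"
  shows "\<exists>qs \<beta>. complete_inst P r \<alpha> (ps @ qs) \<beta> \<or> stuck_inst P r \<alpha> (ps @ qs) \<beta>"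
  using assms(2-)
proof (induction "length (rhs r) - length ps" arbitrary: ps rule: less_induct)
  case less
  let ?h = "length ps"
  let ?f = "funs r ! ?h"
  have b: "snd (last ps) \<in> Params P" (is "?b \<in> _") by (fact less.prems)
  have path: "path \<alpha> ps = butlast (path \<alpha> ps) @ [?b]"
    using last_path[OF less.prems(1), of \<alpha>] append_butlast_last_id[of "path \<alpha> ps"]
    by (simp add: path_def)
  have h: "?h < length (funs r)"
    using less.prems(2) by (simp add: length_funs)
  show ?case
  proof (cases "?f (path \<alpha> ps)")
    case None
    \<comment> \<open>The left-hand side of a stuck rule may carry any output; \<open>?b\<close>
      serves as a known element of \<open>Params P\<close>.\<close>
    have "stuck_inst P r \<alpha> (ps @ []) ?b"
      using less.prems None by (simp add: stuck_inst_def Suc_le_eq)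
    then show ?thesis by blast
  next
    case (Some y)
    have y: "y \<in> Params P"
      using fun_value_in_Params[OF r h Some] .
    have "butlast (path \<alpha> ps) @ [?b, y] \<in> bracket (Params P) (take ?h (funs r) @ [?f])"
      using less.prems(3) b y Some path by (intro bracket_snoc) simp_all
    then have ext: "path \<alpha> ps @ [y] \<in> bracket (Params P) (take (Suc ?h) (funs r))"
      by (subst path) (simp add: take_Suc_conv_app_nth[OF h])
    show ?thesis
    proof (cases "?h = length (rhs r)")
      case True
      \<comment> \<open>Here \<open>?f\<close> is \<open>final r\<close>, so its value
        \<open>y\<close> is the output of the left-hand side.\<close>
      then have "complete_inst P r \<alpha> (ps @ []) y"
        using ext by (simp add: complete_inst_def length_funs)
      then show ?thesis by blast
    next
      case False
      \<comment> \<open>The input \<open>y\<close> of the next symbol is forced; its output is free,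
        and \<open>?b\<close> is reused.\<close>
      have "\<exists>qs \<beta>. complete_inst P r \<alpha> ((ps @ [(y, ?b)]) @ qs) \<beta> \<or>
                  stuck_inst P r \<alpha> ((ps @ [(y, ?b)]) @ qs) \<beta>"
        using less.prems(2) False ext b
        by (intro less.hyps) (simp_all add: butlast_path_snoc)
      then show ?thesis by (metis append.assoc)
    qed
  qed
qed

lemma induced_item_with_output:
  assumes item: "(r, d, i, j, \<rho>) \<in> pitems P D" and d: "d < length (rhs r)"
    and \<beta>: "\<beta> \<in> Params P"
  obtains L w where "((L, w), d, i, j) \<in> induced_items_of P (r, d, i, j, \<rho>)"
    and "d < length w" and "w ! d = Sym (symbols r ! d) (\<rho> ! (2 * d + 1)) \<beta>"
proof -
  have r: "r \<in> Rules P" and \<rho>: "\<rho> \<in> bracket (Params P) (take (Suc d) (funs r))"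
    using item by (auto simp: pitems_def)
  have len: "length \<rho> = 2 * Suc d"
    using \<rho> d by (simp add: bracket_def length_funs)
  \<comment> \<open>\<open>\<rho>\<close> ends with the input of the symbol after the dot, so
    appending \<open>\<beta>\<close> completes the pair of that symbol.\<close>
  then obtain \<alpha> ps where path: "\<rho> @ [\<beta>] = path \<alpha> ps" and lps: "length ps = Suc d"
    using odd_list_is_path[of "\<rho> @ [\<beta>]" "Suc d"] by auto
  have ne: "ps \<noteq> []" using lps by auto
  have butlast: "butlast (path \<alpha> ps) = \<rho>" and last: "snd (last ps) = \<beta>"
    using last_path[OF ne, of \<alpha>] by (simp_all flip: path)
  have fst: "fst (ps ! d) = \<rho> ! (2 * d + 1)"
    using path_nth[of d ps \<alpha>] len lps by (simp add: nth_append flip: path)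
  have snd: "snd (ps ! d) = \<beta>"
    using last ne lps by (simp add: last_conv_nth)
  obtain qs \<gamma> where
    "complete_inst P r \<alpha> (ps @ qs) \<gamma> \<or> stuck_inst P r \<alpha> (ps @ qs) \<gamma>"
    using extend_to_induced_rule[OF r ne, of \<alpha>] d lps \<rho> \<beta> butlast last by auto
  then show thesis
  proof
    assume c: "complete_inst P r \<alpha> (ps @ qs) \<gamma>"
    have le: "length (ps @ qs) \<le> length (rhs r)"
      using c by (simp add: complete_inst_def)
    have "take (2 * (d + 1)) (path \<alpha> (ps @ qs) @ [\<gamma>]) = \<rho>"
      using take_path_append[of ps \<alpha> qs] lps butlast by (simp add: length_path)
    then have "(complete_rule r \<alpha> (ps @ qs) \<gamma>, d, i, j) \<in> induced_items_of P (r, d, i, j, \<rho>)"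
      using c by auto
    then show thesis
      unfolding complete_rule_def
      by (rule that)
        (use inst_symbols_nth[of d "ps @ qs" r] length_inst_symbols[OF le] le lps fst snd in
          \<open>simp_all add: nth_append\<close>)
  next
    assume s: "stuck_inst P r \<alpha> (ps @ qs) \<gamma>"
    have le: "length (ps @ qs) \<le> length (rhs r)"
      using s by (simp add: stuck_inst_def)
    \<comment> \<open>The path has at least \<open>2 * (d + 1) + 1\<close> entries, so dropping its
      last one does not touch this prefix.\<close>
    have "take (2 * (d + 1)) (butlast (path \<alpha> (ps @ qs))) = \<rho>"
      using take_path_append[of ps \<alpha> qs] lps butlast
      by (simp add: length_path take_butlast)
    then have "(stuck_rule r \<alpha> (ps @ qs) \<gamma>, d, i, j) \<in> induced_items_of P (r, d, i, j, \<rho>)"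
      unfolding induced_items_of.simps
      by (intro UnI2 CollectI exI conjI) (use s lps in simp_all)
    then show thesis
      unfolding stuck_rule_def
      by (rule that)
        (use inst_symbols_nth[of d "ps @ qs" r] length_inst_symbols[OF le] le lps fst snd in
          \<open>simp_all add: nth_append\<close>)
  qed
qed

end

section \<open>From ordinary items back to parameterized items\<close>

text \<open>In a stuck rule the bound \<open>d \<le> length ps - 1\<close> keeps the dot before an
  instantiated symbol, never before \<open>Bot\<close>. In both kinds of rule the prefix of length
  \<open>2 * (d + 1)\<close> therefore ends with the input of the symbol after the dot.\<close>

lemma induced_items_of_nth:
  assumes "((L, w), d, i, j) \<in> induced_items_of P (r, d', i', j', \<rho>)"
    and "d < length w" and "w ! d = Sym X a b"
  shows "d' = d \<and> i' = i \<and> j' = j \<and> d < length (rhs r) \<and> X = symbols r ! d \<and> a = \<rho> ! (2 * d + 1)"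
proof -
  from assms(1) consider
    (complete) \<alpha> ps \<beta> where "(L, w) = complete_rule r \<alpha> ps \<beta>" "complete_inst P r \<alpha> ps \<beta>"
      "take (2 * (d + 1)) (path \<alpha> ps @ [\<beta>]) = \<rho>" "d' = d" "i' = i" "j' = j"
  | (stuck) \<alpha> ps \<beta> where "(L, w) = stuck_rule r \<alpha> ps \<beta>" "stuck_inst P r \<alpha> ps \<beta>"
      "d \<le> length ps - 1" "take (2 * (d + 1)) (butlast (path \<alpha> ps)) = \<rho>" "d' = d" "i' = i" "j' = j"
    by auto
  then show ?thesis
  proof cases
    case complete
    then have w: "w = inst_symbols r ps" and len: "length ps = length (rhs r)"
      by (simp_all add: complete_rule_def complete_inst_def)
    then have d: "d < length ps"
      using assms(2) by (simp add: length_inst_symbols)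
    then have "\<rho> ! (2 * d + 1) = fst (ps ! d)"
      using path_nth[OF d, of \<alpha>] complete(3) by (auto simp: nth_append length_path)
    then show ?thesis
      using complete w len d assms(3) inst_symbols_nth[of d ps r] by simp
  next
    case stuck
    then have w: "w = inst_symbols r ps @ [Bot]"
      and len: "length ps \<le> length (rhs r)" and "1 \<le> length ps"
      by (simp_all add: stuck_rule_def stuck_inst_def)
    then have d: "d < length ps"
      using stuck(3) by simp
    then have "\<rho> ! (2 * d + 1) = fst (ps ! d)"
      using path_nth[OF d, of \<alpha>] stuck(4) by (auto simp: nth_butlast length_path)
    then show ?thesis
      using stuck w len d assms(3) inst_symbols_nth[of d ps r] length_inst_symbols[OF len]
      by (simp add: nth_append)
  qed
qed

text \<open>The only symbol in a rule for \<open>Top\<close> is a decorated start symbol, hence no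
  terminal by disjointness; \<open>Bot\<close> is no terminal either.\<close>

lemma (in parameterized_local_lexing) terminal_item_in_Norm:
  assumes "I' \<subseteq> items P D" and "((L, w), d, i, j) \<in> I'"
    and "d < length w" and "w ! d \<in> induced_terms P"
  shows "((L, w), d, i, j) \<in> Norm I'"
proof -
  have "L \<noteq> Top"
  proof
    assume "L = Top"
    then obtain \<beta> where "w = [Sym (start_sym P) (start_param P) \<beta>]"
      using assms(1,2)
      by (auto simp: items_def induced_rules_def induced_rules_of_def complete_rule_def
          stuck_rule_def)
    then have "start_sym P \<in> Terms P"
      using assms(3,4) by (simp add: induced_terms_def)
    then show False
      using start_sym disjoint by blast
  qed
  moreover have "drop d w \<noteq> [Bot]"
    using assms(3,4) by (auto simp: induced_terms_def simp flip: Cons_nth_drop_Suc)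
  ultimately show ?thesis
    using assms(2) by (auto simp: Norm_def)
qed

theorem theorem8:
  fixes P :: "('s, 'p, 'c) lexing_data"
    and D :: "'c list" and k :: nat
    and T :: "('s, 'p, 'c) ptoken set"
    and I :: "('s, 'p) pitem set" and I' :: "('s, 'p) item set"
  assumes "parameterized_local_lexing P"
    and "D \<in> lists (Chars P)" and "k \<le> length D"
    and "T \<subseteq> ptokens P"
    and "I \<subseteq> pitems P D" and "I' \<subseteq> items P D"
    and "items_equiv P I I'"
  shows "\<U> ` Tokens P D T k I = Tokens' P D (\<U> ` T) k I'"
proof -
  interpret parameterized_local_lexing P by fact
  have equiv: "induced_items P I = Norm I'"
    using assms(7) by (simp add: items_equiv_def)
  define V where "V = {x | x r d i \<rho>. (r, d, i, k, \<rho>) \<in> I \<and> d < length (rhs r) \<and>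
    symbols r ! d \<in> Terms P \<and> x \<in> Lex P (symbols r ! d) (\<rho> ! (2 * d + 1)) D k}"
  define V' where "V' = {x | x L a t b i. ((L, a @ t # b), length a, i, k) \<in> I' \<and>
    t \<in> induced_terms P \<and> x \<in> induced_Lex P t D k}"
  \<comment> \<open>Stated with a preimage because \<open>induced_Sel\<close> pulls its arguments
    back along \<open>\<U>\<close>.\<close>
  have "\<U> -` V' = V"
  proof (intro equalityI subsetI)
    fix x assume "x \<in> \<U> -` V'"
    then obtain L a s b i where I': "((L, a @ s # b), length a, i, k) \<in> I'"
      and s: "s \<in> induced_terms P" and x: "\<U> x \<in> induced_Lex P s D k"
      by (auto simp: V'_def)
    obtain t \<alpha> \<beta> where t: "s = Sym t \<alpha> \<beta>" "t \<in> Terms P"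
      using s by (auto simp: induced_terms_def)
    have Lex_x: "x \<in> Lex P t \<alpha> D k"
      using x t by (cases x) (auto simp: induced_Lex_def)
    have "((L, a @ s # b), length a, i, k) \<in> Norm I'"
      using s by (intro terminal_item_in_Norm[OF assms(6) I']) simp_all
    then obtain r d i' j \<rho> where "(r, d, i', j, \<rho>) \<in> I"
      and "((L, a @ s # b), length a, i, k) \<in> induced_items_of P (r, d, i', j, \<rho>)"
      unfolding equiv[symmetric] induced_items_def by (metis UN_E surj_pair)
    with induced_items_of_nth[OF this(2), of t \<alpha> \<beta>] t Lex_x show "x \<in> V"
      by (auto simp: V_def)
  next
    fix x assume "x \<in> V"
    then obtain r d i \<rho> where I: "(r, d, i, k, \<rho>) \<in> I" and d: "d < length (rhs r)"
      and t: "symbols r ! d \<in> Terms P"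
      and x: "x \<in> Lex P (symbols r ! d) (\<rho> ! (2 * d + 1)) D k"
      by (auto simp: V_def)
    have item: "(r, d, i, k, \<rho>) \<in> pitems P D"
      using I assms(5) by blast
    have "\<rho> \<in> lists (Params P)" "length \<rho> = 2 * Suc d"
      using item d by (auto simp: pitems_def bracket_def length_funs)
    then have \<alpha>: "\<rho> ! (2 * d + 1) \<in> Params P"
      by (simp add: in_lists_conv_set)
    \<comment> \<open>The output to be built into the ordinary item is read off the token; the axiom
      on \<open>Lex\<close> puts it in \<open>Params P\<close>.\<close>
    obtain \<beta> c where x_eq: "x = (symbols r ! d, \<rho> ! (2 * d + 1), \<beta>, c)" and \<beta>: "\<beta> \<in> Params P"
      using Lex[OF t \<alpha> assms(2,3)] x by blast
    obtain L w where w: "((L, w), d, i, k) \<in> induced_items_of P (r, d, i, k, \<rho>)" "d < length w"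
      "w ! d = Sym (symbols r ! d) (\<rho> ! (2 * d + 1)) \<beta>"
      using induced_item_with_output[OF item d \<beta>] .
    have "((L, w), d, i, k) \<in> Norm I'"
      using w(1) I unfolding equiv[symmetric] induced_items_def by blast
    then have "((L, w), d, i, k) \<in> I'"
      by (simp add: Norm_def)
    moreover have "w = take d w @ w ! d # drop (Suc d) w" "d = length (take d w)"
      using w(2) by (simp_all add: id_take_nth_drop)
    moreover have "w ! d \<in> induced_terms P"
      using w(3) t \<alpha> \<beta> by (simp add: induced_terms_def)
    moreover have "\<U> x \<in> induced_Lex P (w ! d) D k"
      using x x_eq w(3) by (simp add: induced_Lex_def)
    ultimately have "\<U> x \<in> V'"
      unfolding V'_def by (smt (verit, best) mem_Collect_eq)
    then show "x \<in> \<U> -` V'" by simp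
  qed
  then have "\<U> ` Sel P T V = induced_Sel P (\<U> ` T) V'"
    by (simp add: induced_Sel_def inj_vimage_image_eq[OF inj_\<U>])
  then show ?thesis
    by (simp only: Tokens_def Tokens'_def V_def V'_def)
qed

end
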